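(* For $n\ge1$ let $d_{n,2}(q):=\sum_{w\in\mathcal F_{n,2}}q^{\deg_2(G(w))}$. Then for all $n\ge3$, $$d_{n,2}(q)=d_{n-1,2}(q)+q^2d_{n-2,2}(q),$$ with $d_{1,2}(q)=2q^4$ and $d_{2,2}(q)=q^4+2q^5$. Moreover, for all $n\ge1$, $$d_{n,2}(q)=\sum_{i=1}^{n}\left(\binom{n-1-\lfloor i/2\rfloor}{\lfloor (i-1)/2\rfloor}+\binom{n-2-\lfloor (i-1)/2\rfloor}{\lfloor (i-2)/2\rfloor}\right)q^{i+3}.$$
   Context: $\mathcal F_{n,2}$ is the set of binary words $w=w_1\cdots w_n$ with no two consecutive $1$'s. $P(w)$ is the bargraph polyomino formed by the unit squares $[i-1,i]\times[j-1,j]$, $1\le i\le n$, $1\le j\le w_i+1$. $G(w)$ is the graph whose vertices are the corners of the cells of $P(w)$ and whose edges are the cell sides. $\deg_2(G)$ is the number of vertices of degree $2$ in $G$. Binomial coefficients with integer arguments follow the convention $\binom{a}{a}=1$ for every integer $a$ (in particular $\binom{-1}{-1}=1$), $\binom{a}{b}=0$ if $b>a$, and $\binom{a}{b}=0$ if $b<0$ and $b\ne a$. *)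

theory Defs
  imports "HOL-Computational_Algebra.Polynomial"
begin

definition fib_words :: "nat \<Rightarrow> nat list set" where
  "fib_words n = {w. length w = n \<and> set w \<subseteq> {0, 1} \<and>
     (\<forall>i. Suc i < n \<longrightarrow> \<not> (w ! i = 1 \<and> w ! Suc i = 1))}"

text \<open>A unit square \<open>[a, a+1] \<times> [b, b+1]\<close> is represented by its lower left corner \<open>(a, b)\<close>.
  Letters of a word are indexed from 0, so column \<open>a\<close> of the bargraph has height \<open>w ! a + 1\<close>.\<close>

definition bargraph_cells :: "nat list \<Rightarrow> (nat \<times> nat) set" where
  "bargraph_cells w = {(a, b). a < length w \<and> b < w ! a + 1}"

fun cell_corners :: "nat \<times> nat \<Rightarrow> (nat \<times> nat) set" where
  "cell_corners (a, b) = {(a, b), (a + 1, b), (a, b + 1), (a + 1, b + 1)}"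

fun cell_sides :: "nat \<times> nat \<Rightarrow> (nat \<times> nat) set set" where
  "cell_sides (a, b) =
     {{(a, b), (a + 1, b)}, {(a, b + 1), (a + 1, b + 1)},
      {(a, b), (a, b + 1)}, {(a + 1, b), (a + 1, b + 1)}}"

definition bargraph_verts :: "nat list \<Rightarrow> (nat \<times> nat) set" where
  "bargraph_verts w = (\<Union>c\<in>bargraph_cells w. cell_corners c)"

definition bargraph_edges :: "nat list \<Rightarrow> (nat \<times> nat) set set" where
  "bargraph_edges w = (\<Union>c\<in>bargraph_cells w. cell_sides c)"

definition vertex_degree :: "'a set set \<Rightarrow> 'a \<Rightarrow> nat" where
  "vertex_degree E v = card {e \<in> E. v \<in> e}"

definition deg2 :: "nat list \<Rightarrow> nat" where
  "deg2 w = card {v \<in> bargraph_verts w. vertex_degree (bargraph_edges w) v = 2}"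

definition d_poly :: "nat \<Rightarrow> int poly" where
  "d_poly n = (\<Sum>w\<in>fib_words n. monom 1 (deg2 w))"

text \<open>Binomial coefficients with integer arguments, with \<open>int_binom a a = 1\<close> also for
  negative \<open>a\<close>; this differs from \<open>gchoose\<close>.\<close>

definition int_binom :: "int \<Rightarrow> int \<Rightarrow> int" where
  "int_binom a b =
     (if a = b then 1 else if b > a \<or> b < 0 then 0 else int (nat a choose nat b))"

end

theory Submission
  imports Defs
begin

text \<open>
  In a word without two adjacent ones, a corner of the bargraph has degree 2 exactly if it is one
  of the two bottom corners, one of the two outer corners at height 1 above a first or last
  letter 0, or one of the two top corners of a column of height 2. So the statistic is
  \<open>2 + [w\<^sub>1 = 0] + [w\<^sub>n = 0] + 2\<cdot>#ones\<close>. Splitting a word as \<open>0w\<close> or \<open>10w\<close> then yields the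
  recurrence, and the closed form satisfies the same recurrence by Pascal's rule.
\<close>

section \<open>Sides of the bargraph and vertex degrees\<close>

text \<open>Sides are indexed by their left or lower endpoint, so that a side shared by two cells is
  described only once. In \<open>vside\<close> the side may border column \<open>x\<close> or column
  \<open>x - 1\<close>; the guard \<open>0 < x\<close> keeps truncated subtraction from creating a
  column left of the first.\<close>

definition hside :: "nat list \<Rightarrow> nat \<Rightarrow> nat \<Rightarrow> bool" where
  "hside w x y \<longleftrightarrow> x < length w \<and> y \<le> w ! x + 1"

definition vside :: "nat list \<Rightarrow> nat \<Rightarrow> nat \<Rightarrow> bool" where
  "vside w x y \<longleftrightarrow> x < length w \<and> y \<le> w ! x \<or> 0 < x \<and> x - 1 < length w \<and> y \<le> w ! (x - 1)"

text \<open>A horizontal side at positive height is the top of the cell below it, and at height 0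
  the bottom of a lowest cell. A vertical side is the left side of a cell in column \<open>x\<close>
  or the right side of one in column \<open>x - 1\<close>.\<close>

lemma bargraph_edges_eq:
  "bargraph_edges w =
     {{(x, y), (x + 1, y)} |x y. hside w x y} \<union> {{(x, y), (x, y + 1)} |x y. vside w x y}"
    (is "_ = ?H \<union> ?V")
proof
  show "bargraph_edges w \<subseteq> ?H \<union> ?V"
  proof
    fix e assume "e \<in> bargraph_edges w"
    then obtain a b where c: "(a, b) \<in> bargraph_cells w" and e: "e \<in> cell_sides (a, b)"
      unfolding bargraph_edges_def by (metis UN_E surj_pair)
    have "hside w a b" "hside w a (b + 1)" "vside w a b" "vside w (a + 1) b"
      using c by (auto simp: bargraph_cells_def hside_def vside_def)
    then have "{(a, b), (a + 1, b)} \<in> ?H" "{(a, b + 1), (a + 1, b + 1)} \<in> ?H"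
      "{(a, b), (a, b + 1)} \<in> ?V" "{(a + 1, b), (a + 1, b + 1)} \<in> ?V"
      by blast+
    with e show "e \<in> ?H \<union> ?V"
      unfolding cell_sides.simps insert_iff empty_iff by (elim disjE) simp_all
  qed
  have "{(x, y), (x + 1, y)} \<in> bargraph_edges w" if "hside w x y" for x y
  proof (cases y)
    case 0
    with that have "(x, 0) \<in> bargraph_cells w" by (auto simp: hside_def bargraph_cells_def)
    then show ?thesis unfolding bargraph_edges_def using 0 by (intro UN_I) auto
  next
    case (Suc b)
    with that have "(x, b) \<in> bargraph_cells w" by (auto simp: hside_def bargraph_cells_def)
    then show ?thesis unfolding bargraph_edges_def using Suc by (intro UN_I) auto
  qed
  moreover have "{(x, y), (x, y + 1)} \<in> bargraph_edges w" if "vside w x y" for x y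
  proof (cases "x < length w \<and> y \<le> w ! x")
    case True
    then have "(x, y) \<in> bargraph_cells w" by (auto simp: bargraph_cells_def)
    then show ?thesis unfolding bargraph_edges_def by (intro UN_I) auto
  next
    case False
    with that have "(x - 1, y) \<in> bargraph_cells w" "x > 0"
      by (auto simp: vside_def bargraph_cells_def)
    then show ?thesis unfolding bargraph_edges_def by (intro UN_I) auto
  qed
  ultimately show "?H \<union> ?V \<subseteq> bargraph_edges w" by blast
qed

text \<open>A grid point has at most four incident sides: right, left, up and down. Each becomes an
  optional singleton, which reduces the degree to a sum of four truth values.\<close>

lemma incident_edges_eq:
  "{e \<in> bargraph_edges w. (x, y) \<in> e} =
     (if hside w x y then {{(x, y), (x + 1, y)}} else {}) \<union>
     (if 0 < x \<and> hside w (x - 1) y then {{(x - 1, y), (x, y)}} else {}) \<union>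
     (if vside w x y then {{(x, y), (x, y + 1)}} else {}) \<union>
     (if 0 < y \<and> vside w x (y - 1) then {{(x, y - 1), (x, y)}} else {})"
    (is "?L = ?R")
proof
  show "?L \<subseteq> ?R"
  proof
    fix e assume "e \<in> ?L"
    then have mem: "(x, y) \<in> e"
      and "(\<exists>a b. e = {(a, b), (a + 1, b)} \<and> hside w a b) \<or>
        (\<exists>a b. e = {(a, b), (a, b + 1)} \<and> vside w a b)"
      unfolding bargraph_edges_eq by blast+
    then consider a b where "e = {(a, b), (a + 1, b)}" "hside w a b"
      | a b where "e = {(a, b), (a, b + 1)}" "vside w a b"
      by metis
    then show "e \<in> ?R"
    proof cases
      case (1 a b)
      with mem have "y = b \<and> (x = a \<or> x = a + 1)" by auto
      with 1 show ?thesis by (elim conjE disjE) simp_all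
    next
      case (2 a b)
      with mem have "x = a \<and> (y = b \<or> y = b + 1)" by auto
      with 2 show ?thesis by (elim conjE disjE) simp_all
    qed
  qed
  have "{(x - 1, y), (x, y)} \<in> bargraph_edges w" if "0 < x" "hside w (x - 1) y"
    unfolding bargraph_edges_eq using that
    by (intro UnI1 CollectI exI[of _ "x - 1"] exI[of _ y]) auto
  moreover have "{(x, y - 1), (x, y)} \<in> bargraph_edges w" if "0 < y" "vside w x (y - 1)"
    unfolding bargraph_edges_eq using that
    by (intro UnI2 CollectI exI[of _ x] exI[of _ "y - 1"]) auto
  moreover have "{(x, y), (x + 1, y)} \<in> bargraph_edges w" if "hside w x y"
    unfolding bargraph_edges_eq using that by blast
  moreover have "{(x, y), (x, y + 1)} \<in> bargraph_edges w" if "vside w x y"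
    unfolding bargraph_edges_eq using that by blast
  ultimately show "?R \<subseteq> ?L" by (intro Un_least) (simp_all split: if_split)
qed

text \<open>Distinctness is asked only of elements that are both present: at the origin the absent
  left and down sides collapse to the same set under truncated subtraction.\<close>

lemma card_four_optional_singletons:
  assumes "P \<Longrightarrow> Q \<Longrightarrow> a \<noteq> b" "P \<Longrightarrow> R \<Longrightarrow> a \<noteq> c" "P \<Longrightarrow> S \<Longrightarrow> a \<noteq> d"
    "Q \<Longrightarrow> R \<Longrightarrow> b \<noteq> c" "Q \<Longrightarrow> S \<Longrightarrow> b \<noteq> d" "R \<Longrightarrow> S \<Longrightarrow> c \<noteq> d"
  shows "card ((if P then {a} else {}) \<union> (if Q then {b} else {}) \<union>
      (if R then {c} else {}) \<union> (if S then {d} else {})) =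
    of_bool P + of_bool Q + of_bool R + (of_bool S :: nat)"
  using assms by (cases P; cases Q; cases R; cases S) auto

lemma vertex_degree_bargraph:
  "vertex_degree (bargraph_edges w) (x, y) =
     of_bool (hside w x y) + of_bool (0 < x \<and> hside w (x - 1) y) +
     of_bool (vside w x y) + of_bool (0 < y \<and> vside w x (y - 1))"
  unfolding vertex_degree_def incident_edges_eq
  by (rule card_four_optional_singletons) (auto simp: doubleton_eq_iff)

lemma edge_subset_verts: "e \<in> bargraph_edges w \<Longrightarrow> e \<subseteq> bargraph_verts w"
proof -
  assume "e \<in> bargraph_edges w"
  then obtain c where "c \<in> bargraph_cells w" "e \<in> cell_sides c"
    by (auto simp: bargraph_edges_def)
  moreover from this have "e \<subseteq> cell_corners c" by (cases c) auto
  ultimately show ?thesis by (auto simp: bargraph_verts_def)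
qed

text \<open>A point of positive degree lies on an edge, and endpoints of edges are corners of cells.
  Hence the count may range over all grid points.\<close>

lemma deg2_eq_card: "deg2 w = card {v. vertex_degree (bargraph_edges w) v = 2}"
proof -
  have "v \<in> bargraph_verts w" if "vertex_degree (bargraph_edges w) v = 2" for v
  proof -
    have "{e \<in> bargraph_edges w. v \<in> e} \<noteq> {}"
      using that unfolding vertex_degree_def by (metis card.empty zero_neq_numeral)
    then show ?thesis using edge_subset_verts by blast
  qed
  then show ?thesis unfolding deg2_def by (intro arg_cong[where f = card]) auto
qed

section \<open>The degree-2 vertices of a bargraph\<close>

text \<open>The degrees on the line \<open>x\<close> depend only on the columns touching it. On an
  inner line the heights are (1,1), (1,2) or (2,1), and the only possible vertex of degree 2 is the
  top corner of the higher column. Two adjacent ones would instead produce a vertex of degree 3 at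
  height 2.\<close>

lemma degree_two_iff:
  assumes w: "w \<in> fib_words n" and n: "n > 0"
  shows "vertex_degree (bargraph_edges w) (x, y) = 2 \<longleftrightarrow>
     y = 0 \<and> (x = 0 \<or> x = n) \<or> y = 1 \<and> (x = 0 \<and> w ! 0 = 0 \<or> x = n \<and> w ! (n - 1) = 0) \<or>
     y = 2 \<and> (x < n \<and> w ! x = 1 \<or> 0 < x \<and> x - 1 < n \<and> w ! (x - 1) = 1)"
proof -
  have len: "length w = n" using w by (simp add: fib_words_def)
  have le: "w ! i = 0 \<or> w ! i = 1" if "i < n" for i
  proof -
    have "w ! i \<in> {0, 1}" using w that nth_mem[of i w] len unfolding fib_words_def by blast
    then show ?thesis by simp
  qed
  have sep: "w ! i = 0 \<or> w ! Suc i = 0" if "Suc i < n" for i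
    using w that le[of i] le[of "Suc i"] by (auto simp: fib_words_def)
  \<comment> \<open>The cases are the left border, the line between letters \<open>i\<close> and
    \<open>Suc i\<close>, the right border, and lines beyond the graph.\<close>
  consider "x = 0" | i where "x = Suc i" "Suc i < n" | "x = n" "x > 0" | "x > n"
    by (metis linorder_neqE_nat not0_implies_Suc not_gr_zero)
  then show ?thesis
  proof cases
    case 1
    then show ?thesis using n le[of 0]
      unfolding vertex_degree_bargraph hside_def vside_def len
      by (cases "y = 0"; cases "y = 1"; cases "y = 2") (auto simp: of_bool_def)
  next
    case 2
    then show ?thesis using n le[of i] le[of "Suc i"] sep[of i]
      unfolding vertex_degree_bargraph hside_def vside_def len
      by (cases "y = 0"; cases "y = 1"; cases "y = 2") (auto simp: of_bool_def)
  next
    case 3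
    then show ?thesis using n le[of "n - 1"]
      unfolding vertex_degree_bargraph hside_def vside_def len
      by (cases "y = 0"; cases "y = 1"; cases "y = 2") (auto simp: of_bool_def)
  next
    case 4
    then show ?thesis using n
      unfolding vertex_degree_bargraph hside_def vside_def len
      by (auto simp: of_bool_def)
  qed
qed

lemma deg2_fib_word:
  assumes w: "w \<in> fib_words n" and n: "n > 0"
  shows "deg2 w = 2 + of_bool (hd w = 0) + of_bool (last w = 0) + 2 * count_list w 1"
proof -
  have len: "length w = n" and ne: "w \<noteq> []" using w n by (auto simp: fib_words_def)
  define I where "I = {i. i < n \<and> w ! i = 1}"
  have fin: "finite I" by (simp add: I_def)
  have cI: "card I = count_list w 1"
    unfolding I_def count_list_eq_length_filter length_filter_conv_card len
    by (intro arg_cong[where f = card]) auto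
  have sep: "Suc i \<notin> I" if "i \<in> I" for i
    using w that by (auto simp: I_def fib_words_def)
  \<comment> \<open>\<open>A\<close> holds the bottom corners, \<open>B\<close> and \<open>C\<close>
    the outer corners at height 1, \<open>D\<close> and \<open>E\<close> the left and right top
    corners of the columns of height 2.\<close>
  define A where "A = {(0::nat, 0::nat), (n, 0)}"
  define B where "B = (if w ! 0 = 0 then {(0::nat, 1::nat)} else {})"
  define C where "C = (if w ! (n - 1) = 0 then {(n, 1::nat)} else {})"
  define D where "D = (\<lambda>i. (i, 2::nat)) ` I"
  define E where "E = (\<lambda>i. (Suc i, 2::nat)) ` I"
  have "{v. vertex_degree (bargraph_edges w) v = 2} = A \<union> (B \<union> (C \<union> (D \<union> E)))"
  proof (intro set_eqI, clarify)
    fix x y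
    have "(x, y) \<in> E \<longleftrightarrow> y = 2 \<and> 0 < x \<and> x - 1 < n \<and> w ! (x - 1) = 1"
      by (cases x) (auto simp: E_def I_def)
    moreover have "(x, y) \<in> D \<longleftrightarrow> y = 2 \<and> x < n \<and> w ! x = 1"
      by (auto simp: D_def I_def)
    ultimately show "(x, y) \<in> {v. vertex_degree (bargraph_edges w) v = 2} \<longleftrightarrow>
        (x, y) \<in> A \<union> (B \<union> (C \<union> (D \<union> E)))"
      unfolding mem_Collect_eq degree_two_iff[OF w n] Un_iff
      by (auto simp: A_def B_def C_def)
  qed
  moreover have "card (A \<union> (B \<union> (C \<union> (D \<union> E)))) = card A + (card B + (card C + (card D + card E)))"
  proof -
    \<comment> \<open>A common point \<open>(Suc i, 2)\<close> would make letters \<open>i\<close>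
      and \<open>Suc i\<close> both 1.\<close>
    have "D \<inter> E = {}" using sep by (auto simp: D_def E_def)
    moreover have "C \<inter> (D \<union> E) = {}" by (auto simp: C_def D_def E_def)
    moreover have "B \<inter> (C \<union> (D \<union> E)) = {}" using n by (auto simp: B_def C_def D_def E_def)
    moreover have "A \<inter> (B \<union> (C \<union> (D \<union> E))) = {}"
      by (auto simp: A_def B_def C_def D_def E_def)
    moreover have "finite A" "finite B" "finite C" "finite D" "finite E"
      using fin by (auto simp: A_def B_def C_def D_def E_def)
    ultimately show ?thesis by (simp add: card_Un_disjoint)
  qed
  moreover have "card A = 2" using n by (simp add: A_def)
  moreover have "card B = of_bool (hd w = 0)" using ne by (simp add: B_def hd_conv_nth)
  moreover have "card C = of_bool (last w = 0)" using ne len by (simp add: C_def last_conv_nth)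
  moreover have "card D = count_list w 1" "card E = count_list w 1"
    unfolding cI[symmetric] D_def E_def by (intro card_image inj_onI; simp)+
  ultimately show ?thesis by (simp add: deg2_eq_card)
qed

section \<open>Decomposition of the words and the recurrence\<close>

lemma finite_fib_words: "finite (fib_words n)"
  by (rule finite_subset[OF _ finite_lists_length_eq[of "{0, 1}" n]]) (auto simp: fib_words_def)

lemma fib_words_0: "fib_words 0 = {[]}"
  by (auto simp: fib_words_def)

lemma fib_words_1: "fib_words (Suc 0) = {[0], [1]}"
  by (auto simp: fib_words_def length_Suc_conv)

lemma all_nat_split: "(\<forall>i. P i) \<longleftrightarrow> P 0 \<and> (\<forall>i. P (Suc i))"
  by (metis not0_implies_Suc)

text \<open>Prepending a letter adds just one adjacent pair, at positions 0 and 1. The guard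
  \<open>n > 0\<close> is there because \<open>hd []\<close> is unspecified.\<close>

lemma fib_words_Cons:
  "a # w \<in> fib_words (Suc n) \<longleftrightarrow>
     w \<in> fib_words n \<and> (a = 0 \<or> a = 1 \<and> (n > 0 \<longrightarrow> hd w \<noteq> 1))"
proof (cases "length w = n")
  case True
  have "(\<forall>i. Suc i < Suc n \<longrightarrow> \<not> ((a # w) ! i = 1 \<and> (a # w) ! Suc i = 1)) \<longleftrightarrow>
      (n > 0 \<longrightarrow> \<not> (a = 1 \<and> hd w = 1)) \<and>
      (\<forall>i. Suc i < n \<longrightarrow> \<not> (w ! i = 1 \<and> w ! Suc i = 1))"
    using True by (subst all_nat_split) (cases w; auto)
  with True show ?thesis unfolding fib_words_def mem_Collect_eq by auto
qed (auto simp: fib_words_def)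

text \<open>A leading 1 must be followed by 0, and a 0 can precede any word.\<close>

lemma fib_words_Suc_Suc:
  "fib_words (Suc (Suc n)) = (#) 0 ` fib_words (Suc n) \<union> (\<lambda>u. 1 # 0 # u) ` fib_words n"
proof (intro set_eqI)
  fix w :: "nat list"
  show "w \<in> fib_words (Suc (Suc n)) \<longleftrightarrow>
    w \<in> (#) 0 ` fib_words (Suc n) \<union> (\<lambda>u. 1 # 0 # u) ` fib_words n"
  proof (cases "length w = Suc (Suc n)")
    case True
    then obtain a b u where "w = a # b # u" by (auto simp: length_Suc_conv)
    then show ?thesis by (auto simp: fib_words_Cons)
  qed (auto simp: fib_words_def)
qed

lemma sum_fib_words_Suc_Suc:
  "(\<Sum>w\<in>fib_words (Suc (Suc n)). f w) =
     (\<Sum>w\<in>fib_words (Suc n). f (0 # w)) + (\<Sum>u\<in>fib_words n. f (1 # 0 # u))"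
  unfolding fib_words_Suc_Suc
  by (subst sum.union_disjoint) (auto simp: finite_fib_words sum.reindex inj_on_def)

text \<open>Weight of what follows a fixed letter 0, leaving out the bottom corners and the left
  border. Writing \<open>last (0 # w)\<close> makes that 0 the last letter when \<open>w\<close> is
  empty.\<close>

definition tail_poly :: "nat \<Rightarrow> int poly" where
  "tail_poly n = (\<Sum>w\<in>fib_words n. monom 1 (of_bool (last (0 # w) = 0) + 2 * count_list w 1))"

lemma tail_poly_0: "tail_poly 0 = monom 1 1"
  by (simp add: tail_poly_def fib_words_0)

lemma tail_poly_1: "tail_poly (Suc 0) = monom 1 1 + monom 1 2"
  by (simp add: tail_poly_def fib_words_1 numeral_2_eq_2)

lemma tail_poly_Suc_Suc:
  "tail_poly (Suc (Suc n)) = tail_poly (Suc n) + monom 1 2 * tail_poly n"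
  by (simp add: tail_poly_def sum_fib_words_Suc_Suc sum_distrib_left mult_monom algebra_simps)

lemma d_poly_1: "d_poly (Suc 0) = monom 2 4"
  by (simp add: d_poly_def fib_words_1 deg2_fib_word[of _ "Suc 0"] add_monom eval_nat_numeral)

text \<open>A first letter 0 contributes 1 besides the two bottom corners, giving exponent 3; a
  leading 1 contributes its two top corners, giving 4.\<close>

lemma d_poly_Suc_Suc:
  "d_poly (Suc (Suc n)) = monom 1 3 * tail_poly (Suc n) + monom 1 4 * tail_poly n"
proof -
  have "deg2 (0 # w) = 3 + (of_bool (last (0 # w) = 0) + 2 * count_list w 1)"
    if "w \<in> fib_words (Suc n)" for w
    using that by (subst deg2_fib_word[of _ "Suc (Suc n)"]) (auto simp: fib_words_Cons)
  moreover have "deg2 (1 # 0 # u) = 4 + (of_bool (last (0 # u) = 0) + 2 * count_list u 1)"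
    if "u \<in> fib_words n" for u
    using that by (subst deg2_fib_word[of _ "Suc (Suc n)"]) (auto simp: fib_words_Cons)
  ultimately show ?thesis
    by (simp add: d_poly_def sum_fib_words_Suc_Suc tail_poly_def sum_distrib_left mult_monom
        del: last.simps)
qed

lemma d_poly_2: "d_poly (Suc (Suc 0)) = monom 1 4 + monom 2 5"
proof -
  have "monom 2 5 = monom 1 5 + monom (1::int) 5" by (simp add: add_monom)
  then show ?thesis by (simp add: d_poly_Suc_Suc tail_poly_0 tail_poly_1 mult_monom algebra_simps)
qed

text \<open>Being a fixed combination of consecutive \<open>tail_poly\<close> values,
  \<open>d_poly\<close> inherits their recurrence. For \<open>n = 0\<close> the term
  \<open>d_poly (Suc 0)\<close> is not of that form, so this case is computed.\<close>

lemma d_poly_rec: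
  "d_poly (Suc (Suc (Suc n))) = d_poly (Suc (Suc n)) + monom 1 2 * d_poly (Suc n)"
proof (cases n)
  case 0
  have "monom 2 k = monom 1 k + monom (1::int) k" for k by (simp add: add_monom)
  with 0 show ?thesis
    by (simp add: d_poly_Suc_Suc[of "Suc 0"] d_poly_2 d_poly_1 tail_poly_0 tail_poly_1
        tail_poly_Suc_Suc mult_monom algebra_simps)
next
  case (Suc m)
  then show ?thesis by (simp only: d_poly_Suc_Suc tail_poly_Suc_Suc) (simp add: algebra_simps)
qed

section \<open>The closed form\<close>

lemma int_binom_of_nat: "int_binom (int m) (int k) = int (m choose k)"
  by (simp add: int_binom_def)

text \<open>The convention on the diagonal makes this hold for every integer \<open>a\<close>: at
  \<open>a = b = 0\<close> the value 1 comes from \<open>int_binom (-1) (-1)\<close>. For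
  \<open>b = -1\<close>, \<open>a = 0\<close> the identity would fail.\<close>

lemma int_binom_pascal:
  assumes "b \<ge> 0"
  shows "int_binom a b = int_binom (a - 1) b + int_binom (a - 1) (b - 1)"
proof (cases "a > b \<and> b > 0")
  case True
  then obtain m k where "a - 1 = int m" "b - 1 = int k"
    by (metis diff_ge_0_iff_ge int_one_le_iff_zero_less order_less_trans zero_le_imp_eq_int)
  then have "a = int (Suc m)" "b = int (Suc k)" "a - 1 = int m" "b - 1 = int k" by simp_all
  then show ?thesis by (simp only: int_binom_of_nat) simp
next
  case False
  with assms consider "b = 0" | "a = b" "b > 0" | "a < b" "b > 0" by linarith
  then show ?thesis by cases (simp_all add: int_binom_def)
qed

text \<open>The claimed coefficient of degree \<open>i + 3\<close>. Integer \<open>div\<close>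
  rounds down, so it agrees with the floor also at negative numerators, which occur for
  \<open>i\<close> = 0 and 1.\<close>

definition deg2_coeff :: "nat \<Rightarrow> nat \<Rightarrow> int" where
  "deg2_coeff n i = int_binom (int n - 1 - int i div 2) ((int i - 1) div 2)
     + int_binom (int n - 2 - (int i - 1) div 2) ((int i - 2) div 2)"

lemma deg2_coeff_even: "deg2_coeff n (2 * k) = 2 * int_binom (int n - 1 - int k) (int k - 1)"
proof -
  have "(int (2 * k) - 1) div 2 = int k - 1" "int (2 * k) div 2 = int k"
    "(int (2 * k) - 2) div 2 = int k - 1" by presburger+
  then show ?thesis unfolding deg2_coeff_def by (simp only:) (simp add: algebra_simps)
qed

lemma deg2_coeff_odd:
  "deg2_coeff n (2 * k + 1) =
     int_binom (int n - 1 - int k) (int k) + int_binom (int n - 2 - int k) (int k - 1)"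
proof -
  have "(int (2 * k + 1) - 1) div 2 = int k" "int (2 * k + 1) div 2 = int k"
    "(int (2 * k + 1) - 2) div 2 = int k - 1" by presburger+
  then show ?thesis by (simp add: deg2_coeff_def)
qed

lemma deg2_coeff_0: "n > 0 \<Longrightarrow> deg2_coeff n 0 = 0"
  by (simp add: deg2_coeff_def int_binom_def)

text \<open>At \<open>n = 1\<close> the second summand is \<open>int_binom (-1) (-1)\<close> and the
  value is 2, matching \<open>d_poly 1\<close>; hence the bound on \<open>n\<close>.\<close>

lemma deg2_coeff_1: "n \<ge> 2 \<Longrightarrow> deg2_coeff n 1 = 1"
  using deg2_coeff_odd[of n 0] by (auto simp: int_binom_def)

text \<open>For either parity of \<open>i\<close>, the lower indices exceed the upper ones.\<close>

lemma deg2_coeff_eq_0: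
  assumes "i > n" "n > 0"
  shows "deg2_coeff n i = 0"
proof (cases "even i")
  case True
  then obtain k where "i = 2 * k" by blast
  then show ?thesis using assms by (simp add: deg2_coeff_even int_binom_def)
next
  case False
  then obtain k where k: "i = 2 * k + 1" by (elim oddE)
  then show ?thesis using assms by (simp only: k deg2_coeff_odd) (simp add: int_binom_def)
qed

text \<open>Raising \<open>i\<close> by 2 raises \<open>k\<close> by 1, so all lower indices on the
  left are nonnegative and Pascal's rule applies: once for even \<open>i\<close>, where both
  summands agree, and once per summand for odd \<open>i\<close>.\<close>

lemma deg2_coeff_rec:
  "deg2_coeff (Suc (Suc n)) (Suc (Suc i)) = deg2_coeff (Suc n) (Suc (Suc i)) + deg2_coeff n i"
proof (cases "even i")
  case True
  then obtain k where k: "i = 2 * k" by blast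
  then have "Suc (Suc i) = 2 * Suc k" by simp
  then show ?thesis
    using int_binom_pascal[of "int k" "int n - int k"]
    by (simp only: k deg2_coeff_even) (simp add: algebra_simps)
next
  case False
  then obtain k where k: "i = 2 * k + 1" by (elim oddE)
  then have "Suc (Suc i) = 2 * Suc k + 1" by simp
  then show ?thesis
    using int_binom_pascal[of "int k" "int n - 1 - int k"]
      int_binom_pascal[of "int k + 1" "int n - int k"]
    by (simp only: k deg2_coeff_odd) (simp add: algebra_simps)
qed

definition closed_poly :: "nat \<Rightarrow> int poly" where
  "closed_poly n = (\<Sum>i=1..n. monom (deg2_coeff n i) (i + 3))"

text \<open>Since \<open>deg2_coeff n\<close> vanishes at 0 and beyond \<open>n\<close>, the formula
  needs no bound on the summation range.\<close>

lemma coeff_closed_poly: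
  assumes "n > 0"
  shows "coeff (closed_poly n) j = (if j < 3 then 0 else deg2_coeff n (j - 3))"
proof (cases "j < 3")
  case True
  then show ?thesis by (simp add: closed_poly_def coeff_sum)
next
  case False
  then obtain i where i: "j = i + 3" by (metis add.commute le_Suc_ex not_less)
  have "coeff (closed_poly n) j = (\<Sum>k\<in>{1..n}. if k = i then deg2_coeff n k else 0)"
    by (simp add: closed_poly_def coeff_sum i)
  also have "\<dots> = deg2_coeff n i"
    using assms deg2_coeff_0[of n] deg2_coeff_eq_0[of n i] by (auto simp: not_le)
  finally show ?thesis by (simp add: i)
qed

lemma closed_poly_rec:
  assumes "n > 0"
  shows "closed_poly (Suc (Suc n)) = closed_poly (Suc n) + monom 1 2 * closed_poly n"
proof (rule poly_eqI)
  fix j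
  \<comment> \<open>The shifted summand starts at degree 5, which is where
    \<open>deg2_coeff_rec\<close> takes over. Degrees 3 and 4 belong to \<open>i\<close> = 0 and 1,
    with coefficients 0 and 1 for both lengths.\<close>
  consider "j < 3" | "j = 3" | "j = 4" | i where "j = Suc (Suc i) + 3"
  proof -
    assume *: "j < 3 \<Longrightarrow> thesis" "j = 3 \<Longrightarrow> thesis" "j = 4 \<Longrightarrow> thesis"
      "\<And>i. j = Suc (Suc i) + 3 \<Longrightarrow> thesis"
    have "j < 3 \<or> j = 3 \<or> j = 4 \<or> j = Suc (Suc (j - 5)) + 3" by linarith
    with * show thesis by blast
  qed
  then show "coeff (closed_poly (Suc (Suc n))) j =
      coeff (closed_poly (Suc n) + monom 1 2 * closed_poly n) j"
    using assms
    by cases (auto simp: coeff_closed_poly coeff_monom_mult deg2_coeff_0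
        deg2_coeff_1[unfolded One_nat_def] deg2_coeff_rec)
qed

text \<open>Both sides satisfy the same second-order recurrence, so agreement at lengths 1 and 2
  suffices.\<close>

lemma d_poly_eq_closed_poly: "d_poly (Suc n) = closed_poly (Suc n)"
proof (induction n rule: less_induct)
  case (less n)
  consider "n = 0" | "n = 1" | m where "n = Suc (Suc m)"
    by (metis One_nat_def not0_implies_Suc)
  then show ?case
  proof cases
    case 1
    then show ?thesis by (simp add: d_poly_1 closed_poly_def deg2_coeff_def int_binom_def)
  next
    case 2
    then show ?thesis
      by (simp add: d_poly_2 closed_poly_def deg2_coeff_def int_binom_def numeral_2_eq_2)
  next
    case 3
    then show ?thesis using less.IH[of m] less.IH[of "Suc m"]
      by (simp add: d_poly_rec closed_poly_rec)
  qed
qed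

theorem theorem3p5:
  shows "(\<forall>n\<ge>3. d_poly n = d_poly (n - 1) + monom 1 2 * d_poly (n - 2))
    \<and> d_poly 1 = monom 2 4
    \<and> d_poly 2 = monom 1 4 + monom 2 5
    \<and> (\<forall>n\<ge>1. d_poly n =
          (\<Sum>i=1..n. monom
             (int_binom (int n - 1 - int i div 2) ((int i - 1) div 2)
              + int_binom (int n - 2 - (int i - 1) div 2) ((int i - 2) div 2)) (i + 3)))"
proof (intro conjI allI impI)
  fix n :: nat assume "n \<ge> 3"
  then obtain m where "n = Suc (Suc (Suc m))"
    using that[of "n - 3"] by simp
  then show "d_poly n = d_poly (n - 1) + monom 1 2 * d_poly (n - 2)"
    by (simp add: d_poly_rec)
next
  show "d_poly 1 = monom 2 4" by (simp add: d_poly_1)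
  show "d_poly 2 = monom 1 4 + monom 2 5" using d_poly_2 by (simp add: numeral_2_eq_2)
next
  fix n :: nat assume "n \<ge> 1"
  then have "d_poly n = closed_poly n" using d_poly_eq_closed_poly[of "n - 1"] by simp
  then show "d_poly n =
          (\<Sum>i=1..n. monom
             (int_binom (int n - 1 - int i div 2) ((int i - 1) div 2)
              + int_binom (int n - 2 - (int i - 1) div 2) ((int i - 2) div 2)) (i + 3))"
    by (simp only: closed_poly_def deg2_coeff_def)
qed

end
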